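(* Let $G$ be a finitely generated group, let $H$ be a proper normal subgroup of $G$ of finite index, and let $A$ be a finite set with at least two elements. Then: 1. $\alpha_{[H]}(G;A) = 1$ if and only if $|A|=2$ and $[G:H]=2$. 2. $\alpha_{[H]}(G;A) = 2$ if and only if either ($|A|=2$ and $[G:H]=3$) or ($|A|=2$ and $G/H\cong \mathbb{Z}_2\oplus\mathbb{Z}_2$). 3. $\alpha_{[H]}(G;A) = 3$ if and only if either ($|A|=3$ and $[G:H]=2$) or ($|A|=2$ and $G/H\cong\mathbb{Z}_4$). 4. $\alpha_{[H]}(G;A) = 6$ if and only if either ($|A|=2$ and $[G:H]=5$) or ($|A|=4$ and $[G:H]=2$). 5. $\alpha_{[H]}(G;A) = 7$ if and only if $|A|=2$ and $G/H\cong S_3$. 6. $\alpha_{[H]}(G;A) = 8$ if and only if $|A|=3$ and $[G:H]=3$. 7. $\alpha_{[H]}(G;A) = 9$ if and only if $|A|=2$ and $G/H\cong\mathbb{Z}_6$. 8. $\alpha_{[H]}(G;A) = 10$ if and only if $|A|=5$ and $[G:H]=2$. 9. $\alpha_{[H]}(G;A)\neq 4$ and $\alpha_{[H]}(G;A)\neq 5$.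
   Context: For a group $G$ and a set $A$, $A^G$ is the set of all functions $G\to A$ (called configurations), with the shift action $(g\cdot x)(h) := x(g^{-1}h)$ for $g,h\in G$, $x\in A^G$. The stabiliser of $x\in A^G$ is $G_x := \{g\in G : g\cdot x = x\}$ and its $G$-orbit is $Gx := \{g\cdot x : g\in G\}$. For a subgroup $H\leq G$, $[H] := \{gHg^{-1} : g\in G\}$ is the conjugacy class of $H$, and $\alpha_{[H]}(G;A) := |\{Gx : x\in A^G,\ [G_x]=[H]\}|$ is the number of $G$-orbits in $A^G$ whose stabilisers are conjugate to $H$. $\mathbb{Z}_n$ is the cyclic group of order $n$ and $S_3$ is the symmetric group on three letters. *)

theory Defs
  imports "HOL-Algebra.Algebra"
begin

definition finitely_generated :: "('a, 'm) monoid_scheme \<Rightarrow> bool"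
  where "finitely_generated G \<longleftrightarrow>
    (\<exists>S. S \<subseteq> carrier G \<and> finite S \<and> generate G S = carrier G)"

(* Functions are extensional, so that equality in this set is equality on carrier G
   and card counts genuine configurations. *)
definition configs :: "('a, 'm) monoid_scheme \<Rightarrow> 'b set \<Rightarrow> ('a \<Rightarrow> 'b) set"
  where "configs G A = carrier G \<rightarrow>\<^sub>E A"

(* Both restrictions only fix values outside the domains; they make
   shift G A an action in the sense of the locale group_action. *)
definition shift ::
    "('a, 'm) monoid_scheme \<Rightarrow> 'b set \<Rightarrow> 'a \<Rightarrow> ('a \<Rightarrow> 'b) \<Rightarrow> ('a \<Rightarrow> 'b)"
  where "shift G A g = (\<lambda>x \<in> configs G A. \<lambda>h \<in> carrier G. x (inv\<^bsub>G\<^esub> g \<otimes>\<^bsub>G\<^esub> h))"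

definition conj_class :: "('a, 'm) monoid_scheme \<Rightarrow> 'a set \<Rightarrow> 'a set set"
  where "conj_class G H = {g <#\<^bsub>G\<^esub> H #>\<^bsub>G\<^esub> inv\<^bsub>G\<^esub> g | g. g \<in> carrier G}"

definition num_orbits_stab ::
    "('a, 'm) monoid_scheme \<Rightarrow> 'b set \<Rightarrow> 'a set \<Rightarrow> nat"
  where "num_orbits_stab G A H =
    card {orbit G (shift G A) x | x.
      x \<in> configs G A \<and> conj_class G (stabilizer G (shift G A) x) = conj_class G H}"

lemma shift_in_configs:
  assumes "group G" "g \<in> carrier G" "x \<in> configs G A"
  shows "shift G A g x \<in> configs G A"
proof -
  interpret group G by fact
  show ?thesis using assms(2,3) by (simp add: shift_def configs_def PiE_iff)
qed

lemma shift_one: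
  assumes "group G" "x \<in> configs G A"
  shows "shift G A \<one>\<^bsub>G\<^esub> x = x"
proof -
  interpret group G by fact
  have "(\<lambda>h\<in>carrier G. x (inv\<^bsub>G\<^esub> \<one>\<^bsub>G\<^esub> \<otimes>\<^bsub>G\<^esub> h)) = restrict x (carrier G)"
    by (rule restrict_ext) simp
  then show ?thesis
    using assms(2) by (simp add: shift_def configs_def PiE_iff extensional_restrict)
qed

lemma shift_mult:
  assumes "group G" "g \<in> carrier G" "k \<in> carrier G" "x \<in> configs G A"
  shows "shift G A (g \<otimes>\<^bsub>G\<^esub> k) x = shift G A g (shift G A k x)"
proof -
  interpret group G by fact
  have "shift G A k x \<in> configs G A" by (rule shift_in_configs) fact+
  then have "shift G A g (shift G A k x) =
      (\<lambda>h \<in> carrier G. shift G A k x (inv\<^bsub>G\<^esub> g \<otimes>\<^bsub>G\<^esub> h))"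
    by (simp add: shift_def)
  also have "\<dots> = (\<lambda>h \<in> carrier G. x (inv\<^bsub>G\<^esub> (g \<otimes>\<^bsub>G\<^esub> k) \<otimes>\<^bsub>G\<^esub> h))"
    using assms(2-4) by (intro restrict_ext) (simp add: shift_def inv_mult_group m_assoc)
  finally show ?thesis using assms(4) by (simp add: shift_def)
qed

lemma group_action_shift:
  assumes "group G"
  shows "group_action G (configs G A) (shift G A)"
proof -
  interpret group G by fact
  have inv: "shift G A k (shift G A g x) = x"
    if "g \<in> carrier G" "k \<in> carrier G" "k \<otimes>\<^bsub>G\<^esub> g = \<one>\<^bsub>G\<^esub>" "x \<in> configs G A" for g k x
    using shift_mult[OF assms that(2,1,4)] shift_one[OF assms that(4)] that(3) by simp
  have bij: "shift G A g \<in> Bij (configs G A)" if g: "g \<in> carrier G" for g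
  proof -
    have "bij_betw (shift G A g) (configs G A) (configs G A)"
      by (rule bij_betw_byWitness[where f' = "shift G A (inv\<^bsub>G\<^esub> g)"])
        (use g in \<open>simp_all add: inv image_subset_iff shift_in_configs[OF assms]\<close>)
    then show ?thesis by (simp add: Bij_def shift_def)
  qed
  have "shift G A (g \<otimes>\<^bsub>G\<^esub> k) = compose (configs G A) (shift G A g) (shift G A k)"
    if "g \<in> carrier G" "k \<in> carrier G" for g k
  proof (rule extensionalityI[of _ "configs G A"])
    show "shift G A (g \<otimes>\<^bsub>G\<^esub> k) \<in> extensional (configs G A)"
      by (simp add: shift_def)
  qed (simp_all add: compose_eq shift_mult[OF assms that])
  then have "shift G A \<in> hom G (BijGroup (configs G A))"
    using bij by (simp add: hom_def BijGroup_def Pi_iff)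
  then show ?thesis
    by (simp add: group_action_def group_hom_def group_hom_axioms_def assms group_BijGroup)
qed

end

theory Submission
  imports Defs
begin

text \<open>
  Put \<open>K = G/H\<close>, \<open>n = |K|\<close> and \<open>q = |A|\<close>.  Since \<open>H\<close> is normal, its conjugacy class is \<open>{H}\<close>,
  and a configuration fixed by \<open>H\<close> is the same thing as a configuration over \<open>K\<close>; its stabilizer
  is exactly \<open>H\<close> iff the corresponding configuration over \<open>K\<close> is free, that is, has trivial
  stabilizer.  Every orbit in question has \<open>n\<close> elements, so \<open>\<alpha> n\<close> is the number \<open>f\<close> of free
  configurations over the finite group \<open>K\<close> (\<open>num_orbits_stab_quotient\<close>).

  An element of order \<open>d\<close> fixes \<open>q ^ (n / d)\<close> configurations.  A crude union bound over the
  nontrivial elements gives \<open>q ^ n \<le> f + (n - 1) q ^ (n div 2)\<close>, which forces \<open>f > 10 n\<close> except when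
  \<open>n = 2, q \<le> 5\<close>, or \<open>n = 3, q \<le> 3\<close>, or \<open>n \<in> {4, 5, 6}, q = 2\<close> (\<open>many_free_configs_bound\<close>).  In particular
  infinitely many pairs \<open>(n, q)\<close> are discarded at one stroke, and only orders up to 6 remain.

  For the remaining groups \<open>f\<close> is computed exactly by \<open>card_free_configs\<close>: choose a set \<open>S\<close> of
  nontrivial elements that meets every nontrivial subgroup and any two members of which
  generate \<open>K\<close>.  A configuration is then not free iff some member of \<open>S\<close> fixes it, and the
  fixed-point sets of different members overlap only in the constant configurations, so
  inclusion-exclusion collapses to a single sum.  Such an \<open>S\<close> exists for groups of prime order (a
  generator), for \<open>Z\<^sub>4\<close> and \<open>Z\<^sub>6\<close> (elements of prime order, one per prime), for \<open>Z\<^sub>2 \<times> Z\<^sub>2\<close> (the three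
  involutions) and for \<open>S\<^sub>3\<close> (a 3-cycle and the three involutions).

  Groups of order 4 and 6 are told apart by whether they contain an element of order \<open>n\<close>.  If not,
  generators are chosen that determine the whole multiplication table, so that any two such
  groups of equal order are isomorphic; applied to \<open>Z\<^sub>2 \<times> Z\<^sub>2\<close> and to \<open>S\<^sub>3\<close> this yields the
  classification.  For \<open>q = 2\<close> the two possible types of each order give different values of \<open>\<alpha>\<close>,
  so \<open>\<alpha>\<close> recognizes the isomorphism type.
\<close>

section \<open>Orbits with a normal stabilizer\<close>

context group
begin

lemma mem_stabilizer_shift_iff:
  assumes "x \<in> configs G A"
  shows "g \<in> stabilizer G (shift G A) x \<longleftrightarrow>
    g \<in> carrier G \<and> (\<forall>h\<in>carrier G. x (g \<otimes> h) = x h)"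
proof (cases "g \<in> carrier G")
  case g: True
  have "shift G A g x = x \<longleftrightarrow> (\<forall>h\<in>carrier G. shift G A g x h = x h)"
  proof
    assume "\<forall>h\<in>carrier G. shift G A g x h = x h"
    then show "shift G A g x = x"
      using shift_in_configs[OF is_group g assms] assms
      unfolding configs_def by (intro PiE_ext) auto
  qed simp
  also have "\<dots> \<longleftrightarrow> (\<forall>h\<in>carrier G. x (inv g \<otimes> h) = x h)"
    using assms by (simp add: shift_def)
  also have "\<dots> \<longleftrightarrow> (\<forall>h\<in>carrier G. x (g \<otimes> h) = x h)"
  proof safe
    fix h assume h: "h \<in> carrier G"
    show "x (g \<otimes> h) = x h" if "\<forall>h\<in>carrier G. x (inv g \<otimes> h) = x h"
      using that[rule_format, of "g \<otimes> h"] g h by (simp add: m_assoc[symmetric])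
    show "x (inv g \<otimes> h) = x h" if "\<forall>h\<in>carrier G. x (g \<otimes> h) = x h"
      using that[rule_format, of "inv g \<otimes> h"] g h by (simp add: m_assoc[symmetric])
  qed
  finally show ?thesis using g by (simp add: stabilizer_def)
qed (simp add: stabilizer_def)

lemma subgroup_stabilizer_shift:
  "x \<in> configs G A \<Longrightarrow> subgroup (stabilizer G (shift G A) x) G"
  by (rule group_action.stabilizer_subgroup[OF group_action_shift[OF is_group]])

text \<open>
  Being fixed by all of \<open>L\<close> means being constant on the right cosets of \<open>L\<close>, because the shift by
  \<open>g\<close> reads a configuration at the left translate \<open>g\<inverse> h\<close>.  For general \<open>L\<close> this counts fixed
  points; for normal \<open>L\<close> it identifies them with the configurations over \<open>G Mod L\<close>.
\<close>

lemma bij_betw_fixed_configs: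
  assumes L: "subgroup L G"
  shows "bij_betw (\<lambda>y. \<lambda>g\<in>carrier G. y (L #> g)) (rcosets L \<rightarrow>\<^sub>E A)
    {x \<in> configs G A. L \<subseteq> stabilizer G (shift G A) x}"
proof (rule bij_betwI')
  have Lc: "L \<subseteq> carrier G" using L by (rule subgroup.subset)
  fix y z assume y: "y \<in> rcosets L \<rightarrow>\<^sub>E A"
  have conf: "(\<lambda>g\<in>carrier G. y (L #> g)) \<in> configs G A"
    using y Lc by (auto simp: configs_def rcosetsI)
  have "x \<in> stabilizer G (shift G A) (\<lambda>g\<in>carrier G. y (L #> g))" if x: "x \<in> L" for x
  proof -
    have "L #> (x \<otimes> h) = L #> h" if h: "h \<in> carrier G" for h
      using coset_mult_assoc[of L x h] coset_join2[OF _ L x] x h Lc by auto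
    then show ?thesis unfolding mem_stabilizer_shift_iff[OF conf] using x Lc by auto
  qed
  then show "(\<lambda>g\<in>carrier G. y (L #> g)) \<in>
      {x \<in> configs G A. L \<subseteq> stabilizer G (shift G A) x}"
    using conf by blast
  assume z: "z \<in> rcosets L \<rightarrow>\<^sub>E A"
  show "((\<lambda>g\<in>carrier G. y (L #> g)) = (\<lambda>g\<in>carrier G. z (L #> g))) = (y = z)"
  proof
    assume eq: "(\<lambda>g\<in>carrier G. y (L #> g)) = (\<lambda>g\<in>carrier G. z (L #> g))"
    show "y = z"
    proof (rule PiE_ext[OF y z])
      fix R assume "R \<in> rcosets L"
      then obtain g where "g \<in> carrier G" "R = L #> g" by (auto simp: RCOSETS_def)
      then show "y R = z R" using fun_cong[OF eq, of g] by simp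
    qed
  qed simp
next
  fix x assume "x \<in> {x \<in> configs G A. L \<subseteq> stabilizer G (shift G A) x}"
  then have x: "x \<in> configs G A" and st: "L \<subseteq> stabilizer G (shift G A) x" by auto
  \<comment> \<open>Any representative may be chosen, as \<open>x\<close> is constant on the coset.\<close>
  define y where "y = (\<lambda>R\<in>rcosets L. x (SOME h. h \<in> R))"
  have y_coset: "y (L #> g) = x g" if g: "g \<in> carrier G" for g
  proof -
    have "(SOME h. h \<in> L #> g) \<in> L #> g" using rcos_self[OF g L] by (rule someI)
    then obtain l where l: "l \<in> L" "(SOME h. h \<in> L #> g) = l \<otimes> g"
      by (auto simp: r_coset_def)
    have "x (l \<otimes> g) = x g"
      using st l(1) g mem_stabilizer_shift_iff[OF x] by blast
    then show ?thesis using g l(2) subgroup.subset[OF L] by (simp add: y_def rcosetsI)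
  qed
  have "y \<in> rcosets L \<rightarrow>\<^sub>E A"
  proof (rule PiE_I)
    fix R assume "R \<in> rcosets L"
    then obtain g where "g \<in> carrier G" "R = L #> g" by (auto simp: RCOSETS_def)
    then show "y R \<in> A" using y_coset x by (auto simp: configs_def)
  qed (simp add: y_def)
  moreover have "x = (\<lambda>g\<in>carrier G. y (L #> g))"
    using x y_coset unfolding configs_def by (intro ext) (auto simp: PiE_iff extensional_def)
  ultimately show "\<exists>y\<in>rcosets L \<rightarrow>\<^sub>E A. x = (\<lambda>g\<in>carrier G. y (L #> g))" by blast
qed

lemma card_fixed_configs:
  assumes "subgroup L G" "finite (rcosets L)"
  shows "card {x \<in> configs G A. L \<subseteq> stabilizer G (shift G A) x} = card A ^ card (rcosets L)"
  using bij_betw_same_card[OF bij_betw_fixed_configs[OF assms(1), of A]] assms(2)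
  by (simp add: card_PiE)

lemma conj_class_normal:
  assumes "H \<lhd> G"
  shows "conj_class G H = {H}"
proof -
  interpret normal H G by fact
  have "g <#\<^bsub>G\<^esub> H #> inv g = H" if g: "g \<in> carrier G" for g
    using g subset coset_eq coset_mult_assoc[of H g "inv g"] by simp
  then show ?thesis unfolding conj_class_def by auto
qed

lemma conj_class_eq_normal_iff:
  assumes "H \<lhd> G" "subgroup S G"
  shows "conj_class G S = conj_class G H \<longleftrightarrow> S = H"
proof
  assume eq: "conj_class G S = conj_class G H"
  \<comment> \<open>Conjugating by the identity shows that \<open>S\<close> belongs to its own class.\<close>
  have "\<one> <#\<^bsub>G\<^esub> S #> inv \<one> = S"
    using subgroup.subset[OF assms(2)] by (simp add: lcos_mult_one coset_mult_one)
  then have "S \<in> conj_class G S" unfolding conj_class_def by (intro CollectI exI[of _ \<one>]) simp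
  then show "S = H" using eq conj_class_normal[OF assms(1)] by simp
qed simp

text \<open>
  The stabilizer of \<open>g x\<close> is the conjugate of that of \<open>x\<close> by \<open>g\<close>, so a normal stabilizer is
  shared by the whole orbit.
\<close>

lemma stabilizer_orbit_normal:
  assumes H: "H \<lhd> G" and act: "group_action G E \<phi>"
    and x: "x \<in> E" "stabilizer G \<phi> x = H" and y: "y \<in> orbit G \<phi> x"
  shows "stabilizer G \<phi> y = H"
proof -
  interpret group_action G E \<phi> by fact
  interpret N: normal H G by fact
  obtain g where g: "g \<in> carrier G" and yg: "y = \<phi> g x"
    using y by (auto simp: orbit_def)
  have "k \<in> stabilizer G \<phi> y \<longleftrightarrow> k \<in> H" if k: "k \<in> carrier G" for k
  proof -
    have yE: "y \<in> E" using element_image[OF g x(1)] yg by simp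
    have eq: "\<phi> (inv g \<otimes> k \<otimes> g) x = \<phi> (inv g) (\<phi> k y)"
      using x(1) g k yg yE composition_rule by simp
    have "\<phi> k y = y \<longleftrightarrow> \<phi> (inv g \<otimes> k \<otimes> g) x = x"
    proof
      show "\<phi> (inv g \<otimes> k \<otimes> g) x = x" if "\<phi> k y = y"
        unfolding eq that using orbit_sym_aux[OF g x(1)] yg by simp
      show "\<phi> k y = y" if "\<phi> (inv g \<otimes> k \<otimes> g) x = x"
      proof -
        have "\<phi> g x = \<phi> k y"
          using orbit_sym_aux[of "inv g" "\<phi> k y" x] that g element_image[OF k yE refl]
          unfolding eq by simp
        then show ?thesis using yg by simp
      qed
    qed
    also have "\<dots> \<longleftrightarrow> inv g \<otimes> k \<otimes> g \<in> H"
      using x(2) g k by (auto simp: stabilizer_def)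
    also have "\<dots> \<longleftrightarrow> k \<in> H"
    proof
      assume "inv g \<otimes> k \<otimes> g \<in> H"
      then have "g \<otimes> (inv g \<otimes> k \<otimes> g) \<otimes> inv g \<in> H" using g by (rule N.inv_op_closed2[rotated])
      moreover have "g \<otimes> (inv g \<otimes> k \<otimes> g) \<otimes> inv g = k"
        using g k by (simp add: m_assoc) (simp add: m_assoc[symmetric])
      ultimately show "k \<in> H" by simp
    qed (use g N.inv_op_closed1 in auto)
    finally show ?thesis using k by (simp add: stabilizer_def)
  qed
  then show ?thesis using stabilizer_subset N.subset by blast
qed

text \<open>
  By the orbit-stabilizer bijection each of the counted orbits has as many elements as \<open>H\<close> has
  cosets.  The group itself may be infinite, which is why the index appears here and not a
  quotient of orders.
\<close>

lemma num_orbits_stab_mult_index: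
  assumes H: "H \<lhd> G" and fin: "finite {x \<in> configs G A. stabilizer G (shift G A) x = H}"
  shows "num_orbits_stab G A H * card (rcosets H) =
    card {x \<in> configs G A. stabilizer G (shift G A) x = H}"
proof -
  interpret act: group_action G "configs G A" "shift G A"
    using group_action_shift[OF is_group] .
  let ?X = "{x \<in> configs G A. stabilizer G (shift G A) x = H}"
  let ?O = "orbit G (shift G A) ` ?X"
  have "{orbit G (shift G A) x | x. x \<in> configs G A \<and>
      conj_class G (stabilizer G (shift G A) x) = conj_class G H} = ?O"
    using conj_class_eq_normal_iff[OF H subgroup_stabilizer_shift] by blast
  then have num: "num_orbits_stab G A H = card ?O" by (simp add: num_orbits_stab_def)
  have sub: "orbit G (shift G A) x \<subseteq> ?X" if "x \<in> ?X" for x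
  proof
    fix y assume y: "y \<in> orbit G (shift G A) x"
    then have "stabilizer G (shift G A) y = H"
      using that stabilizer_orbit_normal[OF H act.group_action_axioms] by blast
    moreover have "y \<in> configs G A"
      using y that act.element_image by (auto simp: orbit_def)
    ultimately show "y \<in> ?X" by blast
  qed
  then have Un: "\<Union>?O = ?X" using act.orbit_refl by blast
  have "card (rcosets H) * card ?O = card (\<Union>?O)"
  proof (rule card_partition)
    show "finite ?O" "finite (\<Union>?O)" using fin Un by auto
    show "card c = card (rcosets H)" if "c \<in> ?O" for c
      using that bij_betw_same_card[OF act.orbit_stab_fun_is_bij] by auto
    show "c \<inter> d = {}" if "c \<in> ?O" "d \<in> ?O" "c \<noteq> d" for c d
      using that act.disjoint_union[of c d] by (auto simp: orbits_def)
  qed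
  then show ?thesis using num Un by (simp add: mult.commute)
qed

end

definition free_configs :: "('a, 'm) monoid_scheme \<Rightarrow> 'b set \<Rightarrow> ('a \<Rightarrow> 'b) set"
  where "free_configs G A = {x \<in> configs G A. stabilizer G (shift G A) x = {\<one>\<^bsub>G\<^esub>}}"

text \<open>
  Pulling back along the projection turns the stabilizer of \<open>y\<close> into its full preimage in \<open>G\<close>,
  which equals the kernel \<open>H\<close> exactly when the stabilizer of \<open>y\<close> is trivial.
\<close>

lemma (in group) bij_betw_free_configs_quotient:
  assumes H: "H \<lhd> G"
  shows "bij_betw (\<lambda>y. \<lambda>g\<in>carrier G. y (H #> g)) (free_configs (G Mod H) A)
    {x \<in> configs G A. stabilizer G (shift G A) x = H}"
proof -
  interpret N: normal H G by fact
  interpret Q: group "G Mod H" by (rule N.factorgroup_is_group)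
  let ?f = "\<lambda>y. \<lambda>g\<in>carrier G. y (H #> g)"
  have bij: "bij_betw ?f (configs (G Mod H) A)
      {x \<in> configs G A. H \<subseteq> stabilizer G (shift G A) x}"
    using bij_betw_fixed_configs[OF N.is_subgroup, of A] by (simp add: configs_def FactGroup_def)
  have iff: "stabilizer G (shift G A) (?f y) = H \<longleftrightarrow> y \<in> free_configs (G Mod H) A"
    if y: "y \<in> configs (G Mod H) A" for y
  proof -
    have fy: "?f y \<in> configs G A" "H \<subseteq> stabilizer G (shift G A) (?f y)"
      using bij_betwE[OF bij] y by auto
    have mem: "g \<in> stabilizer G (shift G A) (?f y) \<longleftrightarrow>
        H #> g \<in> stabilizer (G Mod H) (shift (G Mod H) A) y" if g: "g \<in> carrier G" for g
      unfolding mem_stabilizer_shift_iff[OF fy(1)] Q.mem_stabilizer_shift_iff[OF y]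
      using g by (auto simp: carrier_FactGroup N.rcos_sum)
    have trivial: "H #> g = H \<longleftrightarrow> g \<in> H" if "g \<in> carrier G" for g
      using that coset_join1[OF _ that N.is_subgroup] coset_join2[OF that N.is_subgroup] by auto
    have "stabilizer G (shift G A) (?f y) = H \<longleftrightarrow>
        (\<forall>g\<in>carrier G. g \<in> stabilizer G (shift G A) (?f y) \<longrightarrow> g \<in> H)"
      using fy(2) by (auto simp: stabilizer_def)
    also have "\<dots> \<longleftrightarrow> (\<forall>g\<in>carrier G.
        H #> g \<in> stabilizer (G Mod H) (shift (G Mod H) A) y \<longrightarrow> H #> g = H)"
      using mem trivial by simp
    also have "\<dots> \<longleftrightarrow> stabilizer (G Mod H) (shift (G Mod H) A) y \<subseteq> {H}"
      by (auto simp: stabilizer_def carrier_FactGroup)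
    also have "\<dots> \<longleftrightarrow> stabilizer (G Mod H) (shift (G Mod H) A) y = {\<one>\<^bsub>G Mod H\<^esub>}"
      using subgroup.one_closed[OF Q.subgroup_stabilizer_shift[OF y]] by auto
    finally show ?thesis using y by (simp add: free_configs_def)
  qed
  show ?thesis
    unfolding bij_betw_def
  proof
    show "inj_on ?f (free_configs (G Mod H) A)"
      by (rule inj_on_subset[OF bij_betw_imp_inj_on[OF bij]]) (auto simp: free_configs_def)
    have "?f y \<in> configs G A \<and> H \<subseteq> stabilizer G (shift G A) (?f y)"
      if "y \<in> configs (G Mod H) A" for y
      using bij_betw_apply[OF bij that] by blast
    then have "?f y \<in> {x \<in> configs G A. stabilizer G (shift G A) x = H}"
      if "y \<in> free_configs (G Mod H) A" for y
      using that iff[of y] unfolding free_configs_def by blast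
    moreover have "x \<in> ?f ` free_configs (G Mod H) A"
      if x: "x \<in> configs G A" "stabilizer G (shift G A) x = H" for x
    proof -
      have "x \<in> ?f ` configs (G Mod H) A"
        using bij_betw_imp_surj_on[OF bij] x by blast
      then obtain y where "y \<in> configs (G Mod H) A" "x = ?f y" by (rule imageE)
      then show ?thesis using x(2) iff[of y] by blast
    qed
    ultimately show "?f ` free_configs (G Mod H) A =
        {x \<in> configs G A. stabilizer G (shift G A) x = H}"
      by blast
  qed
qed

lemma finite_configs:
  assumes "finite (carrier G)" "finite A"
  shows "finite (configs G A)" "card (configs G A) = card A ^ order G"
  using assms by (simp_all add: configs_def finite_PiE card_PiE order_def)

proposition (in group) num_orbits_stab_quotient:
  assumes H: "H \<lhd> G" and "finite (rcosets H)" "finite A"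
  shows "num_orbits_stab G A H * order (G Mod H) = card (free_configs (G Mod H) A)"
proof -
  have fin: "finite (free_configs (G Mod H) A)"
    using finite_configs(1)[of "G Mod H" A] assms(2,3)
    by (simp add: free_configs_def FactGroup_def)
  note bij = bij_betw_free_configs_quotient[OF H, of A]
  have "finite {x \<in> configs G A. stabilizer G (shift G A) x = H}"
    using bij_betw_finite[OF bij] fin by blast
  from num_orbits_stab_mult_index[OF H this] bij_betw_same_card[OF bij]
  show ?thesis by (simp add: order_def FactGroup_def)
qed

section \<open>Counting free configurations of a finite group\<close>

context group
begin

lemma card_fixed_by_element:
  assumes g: "g \<in> carrier G" and fin: "finite (carrier G)"
  shows "card {x \<in> configs G A. g \<in> stabilizer G (shift G A) x} = card A ^ (order G div ord g)"
proof -
  have sub: "subgroup (generate G {g}) G" using g by (intro generate_is_subgroup) simp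
  have "g \<in> stabilizer G (shift G A) x \<longleftrightarrow> generate G {g} \<subseteq> stabilizer G (shift G A) x"
    if "x \<in> configs G A" for x
    using generate_subgroup_incl[of "{g}", OF _ subgroup_stabilizer_shift[OF that]]
      generate.incl[of g "{g}" G] by blast
  then have "{x \<in> configs G A. g \<in> stabilizer G (shift G A) x} =
      {x \<in> configs G A. generate G {g} \<subseteq> stabilizer G (shift G A) x}"
    by blast
  moreover have "finite (rcosets (generate G {g}))"
    using fin by (simp add: RCOSETS_def)
  moreover have "card (rcosets (generate G {g})) = order G div ord g"
    using lagrange[OF sub] generate_pow_card[OF g] ord_ge_1[OF fin g]
    by (metis div_mult_self_is_m less_le_trans zero_less_one)
  ultimately show ?thesis using card_fixed_configs[OF sub, of A] by simp
qed

text \<open>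
  The hypothesis \<open>meets\<close> says that members of \<open>S\<close> detect every nontrivial stabilizer, and \<open>gen\<close> says
  that a configuration fixed by two of them is fixed by the whole group, hence constant.
  Therefore the configurations that are not free are the disjoint union of the constant ones
  and, for each member of \<open>S\<close>, the nonconstant ones that it fixes.
\<close>

lemma card_free_configs:
  assumes fin: "finite (carrier G)" and A: "finite A"
    and S: "S \<subseteq> carrier G" "\<one> \<notin> S" "S \<noteq> {}"
    and meets: "\<And>L. subgroup L G \<Longrightarrow> L \<noteq> {\<one>} \<Longrightarrow> L \<inter> S \<noteq> {}"
    and gen: "\<And>L g h. subgroup L G \<Longrightarrow> g \<in> S \<inter> L \<Longrightarrow> h \<in> S \<inter> L \<Longrightarrow> g \<noteq> h \<Longrightarrow> L = carrier G"
  shows "card (free_configs G A) + card A + (\<Sum>g\<in>S. card A ^ (order G div ord g) - card A) =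
    card A ^ order G"
proof -
  let ?st = "stabilizer G (shift G A)"
  define F where "F g = {x \<in> configs G A. g \<in> ?st x}" for g
  define C where "C = {x \<in> configs G A. carrier G \<subseteq> ?st x}"
  have finc: "finite (configs G A)" by (rule finite_configs(1)[OF fin A])
  have finS: "finite S" using S(1) fin by (rule finite_subset)
  have sub: "subgroup (?st x) G" if "x \<in> configs G A" for x
    using that by (rule subgroup_stabilizer_shift)
  have rc: "rcosets (carrier G) = {carrier G}"
    using subgroup_self coset_join2[OF _ subgroup_self] by (auto simp: RCOSETS_def)
  have "card C = card A"
    using card_fixed_configs[OF subgroup_self, of A] by (simp add: C_def rc)
  have CF: "C \<subseteq> F g" if "g \<in> S" for g
    using that S(1) by (auto simp: C_def F_def)
  have cardF: "card (F g - C) = card A ^ (order G div ord g) - card A" if "g \<in> S" for g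
    using card_Diff_subset[OF _ CF[OF that]] card_fixed_by_element[of g A] that S(1) fin \<open>card C = card A\<close>
      finite_subset[OF _ finc, of C]
    by (auto simp: F_def C_def)
  have nonfree: "configs G A - free_configs G A = C \<union> (\<Union>g\<in>S. F g - C)"
  proof
    show "configs G A - free_configs G A \<subseteq> C \<union> (\<Union>g\<in>S. F g - C)"
      using meets[OF sub] by (fastforce simp: free_configs_def F_def)
    have "?st x \<noteq> {\<one>}" if "g \<in> ?st x" "g \<in> S" for g x using that S(2) by auto
    then have F: "F g \<subseteq> configs G A - free_configs G A" if "g \<in> S" for g
      using that unfolding F_def free_configs_def by blast
    then show "C \<union> (\<Union>g\<in>S. F g - C) \<subseteq> configs G A - free_configs G A"
      using CF S(3) by blast
  qed
  have "card (configs G A - free_configs G A) = card C + card (\<Union>g\<in>S. F g - C)"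
    unfolding nonfree
    by (rule card_Un_disjoint) (use finc finS in \<open>auto simp: C_def F_def\<close>)
  also have "card (\<Union>g\<in>S. F g - C) = (\<Sum>g\<in>S. card (F g - C))"
  proof (rule card_UN_disjoint[OF finS])
    show "\<forall>g\<in>S. finite (F g - C)" using finc by (auto simp: F_def)
    show "\<forall>g\<in>S. \<forall>h\<in>S. g \<noteq> h \<longrightarrow> (F g - C) \<inter> (F h - C) = {}"
      using gen[OF sub] by (auto simp: F_def C_def)
  qed
  finally have "card (configs G A - free_configs G A) =
      card A + (\<Sum>g\<in>S. card A ^ (order G div ord g) - card A)"
    using cardF \<open>card C = card A\<close> by simp
  moreover have "free_configs G A \<subseteq> configs G A" by (auto simp: free_configs_def)
  then have "card (free_configs G A) + card (configs G A - free_configs G A) = card (configs G A)"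
    using finc by (metis card_Un_disjoint Diff_disjoint Un_Diff_cancel finite_Diff finite_subset sup.absorb_iff2)
  ultimately show ?thesis using finite_configs(2)[OF fin A] by simp
qed

text \<open>
  Each of the \<open>order G - 1\<close> nontrivial elements has order at least 2, so it fixes at most
  \<open>card A ^ (order G div 2)\<close> configurations; every configuration that is not free is fixed by one of them.
\<close>

lemma card_free_configs_ge:
  assumes fin: "finite (carrier G)" and A: "finite A" "A \<noteq> {}"
  shows "card A ^ order G \<le>
    card (free_configs G A) + (order G - 1) * card A ^ (order G div 2)"
proof -
  let ?F = "\<lambda>g. {x \<in> configs G A. g \<in> stabilizer G (shift G A) x}"
  have finc: "finite (configs G A)" by (rule finite_configs(1)[OF fin A(1)])
  have "configs G A \<subseteq> free_configs G A \<union> (\<Union>g\<in>carrier G - {\<one>}. ?F g)"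
  proof
    fix x assume x: "x \<in> configs G A"
    interpret st: subgroup "stabilizer G (shift G A) x" G
      by (rule subgroup_stabilizer_shift[OF x])
    show "x \<in> free_configs G A \<union> (\<Union>g\<in>carrier G - {\<one>}. ?F g)"
      using x st.one_closed st.subset by (auto simp: free_configs_def)
  qed
  then have "card (configs G A) \<le> card (free_configs G A \<union> (\<Union>g\<in>carrier G - {\<one>}. ?F g))"
    by (rule card_mono[rotated]) (use finc fin in \<open>auto simp: free_configs_def\<close>)
  also have "\<dots> \<le> card (free_configs G A) + card (\<Union>g\<in>carrier G - {\<one>}. ?F g)"
    by (rule card_Un_le)
  also have "card (\<Union>g\<in>carrier G - {\<one>}. ?F g) \<le> (\<Sum>g\<in>carrier G - {\<one>}. card (?F g))"
    by (rule card_UN_le) (use fin in simp)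
  also have "\<dots> \<le> (\<Sum>g\<in>carrier G - {\<one>}. card A ^ (order G div 2))"
  proof (rule sum_mono)
    fix g assume g: "g \<in> carrier G - {\<one>}"
    then have "ord g \<ge> 2" using ord_ge_1[OF fin, of g] ord_eq_1[of g] by auto
    then have "order G div ord g \<le> order G div 2" by (simp add: div_le_mono2)
    moreover have "card A \<ge> 1" using A by (simp add: Suc_le_eq card_gt_0_iff)
    ultimately show "card (?F g) \<le> card A ^ (order G div 2)"
      using card_fixed_by_element[of g A] g fin by (simp add: power_increasing)
  qed
  also have "\<dots> = (order G - 1) * card A ^ (order G div 2)"
    using fin by (simp add: order_def)
  finally show ?thesis by (simp add: finite_configs(2)[OF fin A(1)])
qed

end

text \<open>
  With \<open>k = n div 2\<close> the claim reads \<open>10 n < q ^ k (q ^ (n - k) - (n - 1))\<close>, and the right-hand side grows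
  with \<open>q\<close>.  It therefore suffices to treat, for each \<open>n\<close>, the smallest \<open>q\<close> that is allowed (called \<open>b\<close>
  below): a numerical check for \<open>n \<le> 7\<close>, and \<open>2 ^ k \<ge> 4 k\<close> for \<open>n \<ge> 8\<close>, where \<open>k \<ge> 4\<close>.
\<close>

lemma many_free_configs_bound:
  fixes n q :: nat
  assumes "n \<ge> 2" "q \<ge> 2" "n = 2 \<Longrightarrow> q \<ge> 6" "n = 3 \<Longrightarrow> q \<ge> 4" "4 \<le> n \<Longrightarrow> n \<le> 6 \<Longrightarrow> q \<ge> 3"
  shows "(n - 1) * q ^ (n div 2) + 10 * n < q ^ n"
proof -
  define k where "k = n div 2"
  \<comment> \<open>The smallest alphabet size admitted by the hypotheses for this \<open>n\<close>.\<close>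
  define b where "b = (if n = 2 then 6 else if n = 3 then 4 else if n \<le> 6 then 3 else 2::nat)"
  have "b \<le> q" using assms unfolding b_def by auto
  have base: "10 * n < b ^ k * (b ^ (n - k) - (n - 1))" "n - 1 \<le> b ^ (n - k)"
  proof -
    consider "n = 2" | "n = 3" | "n = 4" | "n = 5" | "n = 6" | "n = 7" | "n \<ge> 8"
      using assms(1) by linarith
    then have "10 * n < b ^ k * (b ^ (n - k) - (n - 1)) \<and> n - 1 \<le> b ^ (n - k)"
    proof cases
      case 7
      then have k: "k \<ge> 4" unfolding k_def by simp
      have p: "2 ^ j \<ge> 4 * j" if "j \<ge> 4" for j :: nat
        using that by (induction j rule: nat_induct_at_least) auto
      have nk: "n - k \<ge> k" "n \<le> 2 * k + 1" unfolding k_def by auto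
      have "2 ^ (n - k) \<ge> (2::nat) ^ k" using nk(1) by (simp add: power_increasing)
      then have ge: "2 ^ (n - k) - (n - 1) \<ge> 2 * k" "n - 1 \<le> 2 ^ (n - k)"
        using p[OF k] nk by linarith+
      have "10 * n \<le> 20 * k + 10" using nk(2) by simp
      also have "\<dots> < 32 * k" using k by simp
      also have "32 * k \<le> 8 * k * k" using k by simp
      also have "8 * k * k = (4 * k) * (2 * k)" by simp
      also have "\<dots> \<le> 2 ^ k * (2 ^ (n - k) - (n - 1))" using p[OF k] ge(1) by (rule mult_le_mono)
      finally show ?thesis using ge(2) 7 by (simp add: b_def)
    qed (simp_all add: b_def k_def)
    then show "10 * n < b ^ k * (b ^ (n - k) - (n - 1))" "n - 1 \<le> b ^ (n - k)" by auto
  qed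
  have "10 * n < q ^ k * (q ^ (n - k) - (n - 1))"
    by (rule less_le_trans[OF base(1)])
       (intro mult_le_mono diff_le_mono power_mono \<open>b \<le> q\<close>; simp)
  also have "\<dots> = q ^ n - (n - 1) * q ^ k"
    by (simp add: k_def diff_mult_distrib2 power_add[symmetric] mult.commute)
  finally show ?thesis unfolding k_def by linarith
qed

section \<open>Cyclic groups and groups of order four\<close>

text \<open>
  Two groups whose elements are indexed by the same set \<open>I\<close>, with the product of the elements
  indexed \<open>i\<close> and \<open>j\<close> having the index \<open>m i j\<close> in both, are identified by matching indices.
  All isomorphisms below are obtained in this way.
\<close>

lemma iso_if_same_table:
  assumes f: "bij_betw f I (carrier G)" and f': "bij_betw f' I (carrier G')"
    and m: "\<And>i j. i \<in> I \<Longrightarrow> j \<in> I \<Longrightarrow> m i j \<in> I"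
    and G: "\<And>i j. i \<in> I \<Longrightarrow> j \<in> I \<Longrightarrow> f (m i j) = f i \<otimes>\<^bsub>G\<^esub> f j"
    and G': "\<And>i j. i \<in> I \<Longrightarrow> j \<in> I \<Longrightarrow> f' (m i j) = f' i \<otimes>\<^bsub>G'\<^esub> f' j"
  shows "G \<cong> G'"
proof -
  let ?h = "f' \<circ> inv_into I f"
  have bij: "bij_betw ?h (carrier G) (carrier G')"
    using bij_betw_inv_into[OF f] f' by (rule bij_betw_trans)
  have hf: "?h (f i) = f' i" if "i \<in> I" for i
    using bij_betw_inv_into_left[OF f that] by simp
  have "?h (x \<otimes>\<^bsub>G\<^esub> y) = ?h x \<otimes>\<^bsub>G'\<^esub> ?h y" if "x \<in> carrier G" "y \<in> carrier G" for x y
  proof -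
    obtain i j where ij: "i \<in> I" "x = f i" "j \<in> I" "y = f j"
      using \<open>x \<in> carrier G\<close> \<open>y \<in> carrier G\<close> bij_betw_imp_surj_on[OF f] by blast
    have "?h (f i \<otimes>\<^bsub>G\<^esub> f j) = f' (m i j)"
      using hf[OF m[OF ij(1,3)]] G[OF ij(1,3)] by metis
    then show ?thesis using ij hf G' by metis
  qed
  then have "?h \<in> iso G G'" using bij bij_betw_apply[OF bij] by (auto simp: iso_def hom_def)
  then show ?thesis unfolding is_iso_def by blast
qed

context group
begin

lemma card_subgroup_dvd: "subgroup L G \<Longrightarrow> card L dvd order G"
  using lagrange by (metis dvd_triv_right)

lemma ord_dvd_card_subgroup:
  assumes L: "subgroup L G" and g: "g \<in> L"
  shows "ord g dvd card L"
proof -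
  have gc: "g \<in> carrier G" using g subgroup.subset[OF L] by blast
  interpret L: group "G\<lparr>carrier := L\<rparr>" using L is_group by (rule subgroup.subgroup_is_group)
  have "subgroup (generate G {g}) (G\<lparr>carrier := L\<rparr>)"
    using subgroup_incl[OF generate_is_subgroup L] generate_subgroup_incl[OF _ L] g gc by simp
  then show ?thesis
    using L.card_subgroup_dvd generate_pow_card[OF gc] by (simp add: order_def)
qed

lemma subgroup_eq_carrier:
  assumes "subgroup L G" "finite (carrier G)" "card L = order G"
  shows "L = carrier G"
  using assms card_subset_eq[OF assms(2) subgroup.subset] by (simp add: order_def)

lemma pow_mod_ord: "a \<in> carrier G \<Longrightarrow> a [^] (m mod ord a) = a [^] (m::nat)"
proof -
  assume a: "a \<in> carrier G"
  have "a [^] m = a [^] (ord a * (m div ord a) + m mod ord a)" by simp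
  also have "\<dots> = (a [^] ord a) [^] (m div ord a) \<otimes> a [^] (m mod ord a)"
    using a by (simp only: nat_pow_mult[symmetric] nat_pow_pow[symmetric])
  finally show ?thesis using a by simp
qed

lemma powers_of_generator:
  assumes fin: "finite (carrier G)" and a: "a \<in> carrier G" "ord a = order G"
  shows "bij_betw (\<lambda>k::nat. a [^] k) {..<order G} (carrier G)"
proof -
  have ivl: "{..<order G} = {0..ord a - 1}"
    using ord_ge_1[OF fin a(1)] a(2) by auto
  have inj: "inj_on (\<lambda>k::nat. a [^] k) {..<order G}"
    unfolding ivl by (rule ord_inj[OF a(1)])
  moreover have "(\<lambda>k::nat. a [^] k) ` {..<order G} = carrier G"
    using card_image[OF inj] a(1) by (intro card_subset_eq[OF fin]) (auto simp: order_def)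
  ultimately show ?thesis by (simp add: bij_betw_def)
qed

text \<open>
  Used to see which elements of prime order lie in a subgroup of a cyclic group: for small
  orders the finitely many exponents \<open>k\<close> can be inspected one by one, choosing a suitable
  multiple \<open>m\<close> for each.
\<close>

lemma powers_in_nontrivial_subgroup:
  assumes fin: "finite (carrier G)" and a: "a \<in> carrier G" "ord a = order G"
    and L: "subgroup L G" "L \<noteq> {\<one>}"
  shows "\<exists>k. 0 < k \<and> k < order G \<and> (\<forall>m. a [^] (k * m mod order G) \<in> L)"
proof -
  obtain g where g: "g \<in> L" "g \<noteq> \<one>" "g \<in> carrier G"
    using L subgroup.one_closed[OF L(1)] subgroup.subset[OF L(1)] by blast
  have "g \<in> (\<lambda>k::nat. a [^] k) ` {..<order G}"
    using bij_betw_imp_surj_on[OF powers_of_generator[OF fin a]] g(3) by blast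
  then obtain k :: nat where k: "k < order G" "g = a [^] k" by blast
  have "a [^] (k * m mod order G) = g [^] m" for m
    using k(2) a pow_mod_ord[OF a(1), of "k * m"] by (simp add: nat_pow_pow)
  moreover have "g [^] m \<in> L" for m :: nat
    using g(1) by (induction m) (auto intro: subgroup.one_closed[OF L(1)] subgroup.m_closed[OF L(1)])
  moreover have "k \<noteq> 0" using k(2) g(2) a(1) by (intro notI) simp
  ultimately show ?thesis using k(1) by (metis neq0_conv)
qed

lemma iso_integer_mod_group:
  assumes fin: "finite (carrier G)" and a: "a \<in> carrier G" "ord a = order G"
  shows "G \<cong> integer_mod_group (order G)"
proof (rule iso_if_same_table)
  have pos: "order G > 0" using fin order_gt_0_iff_finite by simp
  show "bij_betw (\<lambda>k::nat. a [^] k) {..<order G} (carrier G)"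
    by (rule powers_of_generator[OF assms])
  show "bij_betw int {..<order G} (carrier (integer_mod_group (order G)))"
    using pos by (auto simp: bij_betw_def carrier_integer_mod_group image_int_atLeastLessThan
      lessThan_atLeast0)
  show "(i + j) mod order G \<in> {..<order G}" for i j :: nat using pos by simp
  show "a [^] ((i + j) mod order G) = a [^] i \<otimes> a [^] j" for i j :: nat
    using a pow_mod_ord[OF a(1), of "i + j"] by (simp add: nat_pow_mult)
  show "int ((i + j) mod order G) = int i \<otimes>\<^bsub>integer_mod_group (order G)\<^esub> int j" for i j
    by (simp add: zmod_int)
qed

lemma ord_eq_2:
  assumes "g \<in> carrier G" "g \<noteq> \<one>" "g \<otimes> g = \<one>"
  shows "ord g = 2"
proof -
  have "g [^] (2::nat) = \<one>" using assms by (simp add: numeral_2_eq_2)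
  then have "ord g dvd 2" using assms(1) pow_eq_id by simp
  moreover have "ord g \<noteq> 1" using ord_eq_1[OF assms(1)] assms(2) by simp
  ultimately show ?thesis using two_is_prime_nat unfolding prime_nat_iff by blast
qed

text \<open>
  Here \<open>S\<close> consists of one nontrivial element \<open>a\<close>: it generates the group, so it fixes only the
  constant configurations and contributes nothing to the sum.
\<close>

lemma card_free_configs_prime_order:
  assumes fin: "finite (carrier G)" and A: "finite A" and p: "Factorial_Ring.prime (order G)"
  shows "card (free_configs G A) + card A = card A ^ order G"
proof -
  have "card (carrier G) > 1" using prime_gt_1_nat[OF p] by (simp add: order_def)
  then obtain a where a: "a \<in> carrier G" "a \<noteq> \<one>"
    by (metis card.empty card_1_singleton_iff fin is_singletonI' is_singleton_altdef less_irrefl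
        one_closed empty_iff)
  have "ord a = order G"
    using ord_dvd_group_order[OF a(1)] ord_eq_1[OF a(1)] a(2) p by (auto simp: prime_nat_iff)
  moreover have "L \<inter> {a} \<noteq> {}" if L: "subgroup L G" "L \<noteq> {\<one>}" for L
  proof -
    have "card L \<noteq> 1"
      using L(2) subgroup.one_closed[OF L(1)] by (auto simp: card_1_singleton_iff)
    then have "card L = order G"
      using card_subgroup_dvd[OF L(1)] p by (auto simp: prime_nat_iff)
    then show ?thesis using subgroup_eq_carrier[OF L(1) fin] a(1) by simp
  qed
  then have "card (free_configs G A) + card A +
      (\<Sum>g\<in>{a}. card A ^ (order G div ord g) - card A) = card A ^ order G"
    using a by (intro card_free_configs[OF fin A]) auto
  ultimately show ?thesis using a(1) ord_ge_1[OF fin a(1)] by simp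
qed

text \<open>
  The square of a generator is the only involution and lies in every nontrivial subgroup, so \<open>S\<close>
  is that single element.
\<close>

lemma card_free_configs_cyclic4:
  assumes fin: "finite (carrier G)" and A: "finite A" and G: "order G = 4"
    and a: "a \<in> carrier G" "ord a = 4"
  shows "card (free_configs G A) + card A ^ 2 = card A ^ 4"
proof -
  let ?t = "a [^] (2::nat)"
  have t: "?t \<noteq> \<one>" "ord ?t = 2"
    using a pow_eq_id[OF a(1), of 2] ord_pow_gen[OF a(1), of 2] by auto
  have "L \<inter> {?t} \<noteq> {}" if L: "subgroup L G" "L \<noteq> {\<one>}" for L
  proof -
    obtain k where k: "0 < k" "k < 4" and gk: "\<And>m::nat. a [^] (k * m mod 4) \<in> L"
      using powers_in_nontrivial_subgroup[OF fin a(1) _ L] a(2) G by auto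
    have "k = 1 \<or> k = 2 \<or> k = 3" using k by linarith
    then show ?thesis using gk[of 1] gk[of 2] by auto
  qed
  then have "card (free_configs G A) + card A +
      (\<Sum>g\<in>{?t}. card A ^ (order G div ord g) - card A) = card A ^ order G"
    using a t by (intro card_free_configs[OF fin A]) auto
  moreover have "card A \<le> card A ^ 2" by (simp add: power2_eq_square)
  ultimately show ?thesis using t(2) G by simp
qed

text \<open>
  Take \<open>S = {a\<^sup>2, a\<^sup>3}\<close>, one element of order 3 and the involution; a subgroup that contains both
  has order divisible by 6.
\<close>

lemma card_free_configs_cyclic6:
  assumes fin: "finite (carrier G)" and A: "finite A" and G: "order G = 6"
    and a: "a \<in> carrier G" "ord a = 6"
  shows "card (free_configs G A) + card A ^ 2 + card A ^ 3 = card A ^ 6 + card A"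
proof -
  let ?s = "a [^] (2::nat)" and ?t = "a [^] (3::nat)"
  have t: "?t \<noteq> \<one>" "ord ?t = 2" "?s \<noteq> \<one>" "ord ?s = 3"
    using a pow_eq_id[OF a(1)] ord_pow_gen[OF a(1)] by auto
  then have "?s \<noteq> ?t" by auto
  have "L \<inter> {?s, ?t} \<noteq> {}" if L: "subgroup L G" "L \<noteq> {\<one>}" for L
  proof -
    obtain k where k: "0 < k" "k < 6" and gk: "\<And>m::nat. a [^] (k * m mod 6) \<in> L"
      using powers_in_nontrivial_subgroup[OF fin a(1) _ L] a(2) G by auto
    have "k = 1 \<or> k = 2 \<or> k = 3 \<or> k = 4 \<or> k = 5" using k by linarith
    then show ?thesis using gk[of 1] gk[of 2] gk[of 3] by auto
  qed
  moreover have "L = carrier G" if L: "subgroup L G" "?s \<in> L" "?t \<in> L" for L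
  proof (rule subgroup_eq_carrier[OF L(1) fin])
    have "2 dvd card L" "3 dvd card L"
      using ord_dvd_card_subgroup[OF L(1)] L t by metis+
    then have "6 dvd card L" by presburger
    then show "card L = order G" using card_subgroup_dvd[OF L(1)] G by (simp add: dvd_antisym)
  qed
  ultimately have "card (free_configs G A) + card A +
      (\<Sum>g\<in>{?s, ?t}. card A ^ (order G div ord g) - card A) = card A ^ order G"
    using a t by (intro card_free_configs[OF fin A]) auto
  moreover have "card A \<le> card A ^ 2" "card A \<le> card A ^ 3" by (simp_all add: power2_eq_square power3_eq_cube)
  ultimately show ?thesis using t G \<open>?s \<noteq> ?t\<close> by simp
qed

text \<open>
  Take \<open>S\<close> to be all three involutions.  A subgroup with two of them has at least three elements,
  and three does not divide four.
\<close>

lemma card_free_configs_klein4: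
  assumes A: "finite A" and G: "order G = 4"
    and sq: "\<And>x. x \<in> carrier G \<Longrightarrow> x \<otimes> x = \<one>"
  shows "card (free_configs G A) + 3 * card A ^ 2 = card A ^ 4 + 2 * card A"
proof -
  have fin: "finite (carrier G)" using G order_gt_0_iff_finite by simp
  have two: "ord g = 2" if "g \<in> carrier G - {\<one>}" for g
    using that ord_eq_2 sq by simp
  have card: "card (carrier G - {\<one>}) = 3" using G by (simp add: order_def)
  have "L = carrier G" if L: "subgroup L G" and gh: "g \<in> (carrier G - {\<one>}) \<inter> L"
    "h \<in> (carrier G - {\<one>}) \<inter> L" "g \<noteq> h" for L g h
  proof (rule subgroup_eq_carrier[OF L fin])
    have "card {\<one>, g, h} \<le> card L"
      using gh subgroup.one_closed[OF L] finite_subset[OF subgroup.subset[OF L] fin]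
      by (intro card_mono) auto
    moreover have "card {\<one>, g, h} = 3" using gh by auto
    moreover have "card L dvd 4" using card_subgroup_dvd[OF L] G by simp
    moreover have "d dvd 4 \<Longrightarrow> 3 \<le> d \<Longrightarrow> d = 4" for d :: nat
      using dvd_imp_le[of d 4] by (cases "d = 3") auto
    ultimately show "card L = order G" using G by simp
  qed
  moreover have "L \<inter> (carrier G - {\<one>}) \<noteq> {}" if "subgroup L G" "L \<noteq> {\<one>}" for L
    using that subgroup.one_closed[OF that(1)] subgroup.subset[OF that(1)] by blast
  moreover have "carrier G - {\<one>} \<noteq> {}" using card by (metis card.empty zero_neq_numeral)
  ultimately have "card (free_configs G A) + card A +
      (\<Sum>g\<in>carrier G - {\<one>}. card A ^ (order G div ord g) - card A) = card A ^ order G"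
    by (intro card_free_configs[OF fin A]) auto
  moreover have "(\<Sum>g\<in>carrier G - {\<one>}. card A ^ (order G div ord g) - card A) =
      3 * (card A ^ 2 - card A)"
    using two card G by simp
  moreover have "card A \<le> card A ^ 2" by (simp add: power2_eq_square)
  ultimately show ?thesis using G by simp
qed

text \<open>
  A group in which every square is trivial is abelian and a vector space over the field with
  two elements; the index set \<open>bool \<times> bool\<close> gives coordinates in a basis \<open>a, b\<close>, and
  addition of bits is \<open>\<noteq>\<close>.
\<close>

lemma klein4_table:
  assumes G: "order G = 4" and sq: "\<And>x. x \<in> carrier G \<Longrightarrow> x \<otimes> x = \<one>"
  shows "\<exists>f :: bool \<times> bool \<Rightarrow> 'a. bij_betw f UNIV (carrier G) \<and>
    (\<forall>i j k l. f (i \<noteq> k, j \<noteq> l) = f (i, j) \<otimes> f (k, l))"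
proof -
  have fin: "finite (carrier G)" using G order_gt_0_iff_finite by simp
  have notsub: "\<not> carrier G \<subseteq> B" if "finite B" "card B < 4" for B
    using card_mono[OF that(1), of "carrier G"] that(2) G by (auto simp: order_def)
  obtain a where a: "a \<in> carrier G" "a \<noteq> \<one>" using notsub[of "{\<one>}"] by auto
  have "card {\<one>, a} < 4" by (simp add: card_insert_if)
  then obtain b where b: "b \<in> carrier G" "b \<noteq> \<one>" "b \<noteq> a" using notsub[of "{\<one>, a}"] by auto
  have inv_self: "inv x = x" if "x \<in> carrier G" for x using that sq inv_equality by simp
  have comm: "x \<otimes> y = y \<otimes> x" if "x \<in> carrier G" "y \<in> carrier G" for x y
    using inv_mult_group[OF that] that by (simp add: inv_self)
  define f where "f = (\<lambda>(i, j). (if i then a else \<one>) \<otimes> (if j then b else \<one>))"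
  have ab: "a \<otimes> b \<noteq> \<one>" "a \<otimes> b \<noteq> a" "a \<otimes> b \<noteq> b"
    using a b inv_equality[of a b] inv_self by auto
  have inj: "inj f" using a b ab by (auto simp: inj_on_def f_def)
  have "range f = carrier G"
  proof (rule card_subset_eq[OF fin])
    show "range f \<subseteq> carrier G" using a b by (auto simp: f_def)
    show "card (range f) = card (carrier G)"
      using card_image[OF inj] G by (simp add: order_def card_UNIV_bool UNIV_Times_UNIV[symmetric]
        card_cartesian_product del: UNIV_Times_UNIV)
  qed
  moreover have "f (i \<noteq> k, j \<noteq> l) = f (i, j) \<otimes> f (k, l)" for i j k l
  proof -
    have ba: "b \<otimes> a = a \<otimes> b" and aa: "a \<otimes> a = \<one>" and bb: "b \<otimes> b = \<one>"
      using a(1) b(1) sq comm by blast+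
    have aab: "a \<otimes> (a \<otimes> b) = b" and bab: "b \<otimes> (a \<otimes> b) = a"
      using a(1) b(1) aa bb ba by (metis m_assoc l_one, metis m_assoc r_one)
    note rules = ba aa bb aab bab
    show ?thesis
      using a(1) b(1) by (cases i; cases j; cases k; cases l) (simp_all add: f_def rules m_assoc)
  qed
  ultimately show ?thesis using inj by (auto simp: bij_betw_def)
qed

end

section \<open>Groups of order six\<close>

context group
begin

lemma ex_element_of_prime_order:
  assumes fin: "finite (carrier G)" and p: "Factorial_Ring.prime p" "p dvd order G"
  shows "\<exists>x\<in>carrier G. ord x = p"
proof -
  obtain m where "order G = p ^ 1 * m" using p(2) by auto
  then obtain L where L: "subgroup L G" "card L = p"
    using sylow_thm[OF p(1) is_group _ fin, of 1 m] by auto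
  then have "\<not> L \<subseteq> {\<one>}"
    using prime_gt_1_nat[OF p(1)] card_mono[of "{\<one>}" L] by auto
  then obtain x where x: "x \<in> L" "x \<noteq> \<one>" by blast
  then have xc: "x \<in> carrier G" using subgroup.subset[OF L(1)] by blast
  have "ord x \<noteq> 1" using ord_eq_1[OF xc] x(2) by simp
  then have "ord x = p"
    using ord_dvd_card_subgroup[OF L(1) x(1)] L(2) p(1) unfolding prime_nat_iff by blast
  then show ?thesis using xc by blast
qed

text \<open>
  By Cauchy there are \<open>r\<close> of order 3 and \<open>s\<close> of order 2, and since \<open>s\<close> lies outside the subgroup
  generated by \<open>r\<close>, the six products \<open>r\<^sup>i s\<^sup>j\<close> are distinct and exhaust the group.  So \<open>s r\<close> is one of
  them, and all candidates except \<open>r\<^sup>2 s\<close> are excluded: powers of \<open>r\<close> and \<open>s\<close> itself trivially, and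
  \<open>r s\<close> because then \<open>r\<close> and \<open>s\<close> would commute and \<open>r s\<close> would have order 6.
\<close>

lemma order6_relations:
  assumes G: "order G = 6" and no6: "\<And>x. x \<in> carrier G \<Longrightarrow> ord x \<noteq> 6"
  obtains r s where "r \<in> carrier G" "s \<in> carrier G" "ord r = 3" "ord s = 2"
    "bij_betw (\<lambda>(i::nat, j::nat). r [^] i \<otimes> s [^] j) ({..<3} \<times> {..<2}) (carrier G)"
    "s \<otimes> r = r [^] (2::nat) \<otimes> s"
proof -
  have fin: "finite (carrier G)" using G order_gt_0_iff_finite by simp
  obtain r where r: "r \<in> carrier G" "ord r = 3"
    using ex_element_of_prime_order[OF fin, of 3] G by auto
  obtain s where s: "s \<in> carrier G" "ord s = 2"
    using ex_element_of_prime_order[OF fin, of 2] G by auto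
  have L: "subgroup (generate G {r}) G" using r(1) by (intro generate_is_subgroup) simp
  have rL: "r [^] i \<in> generate G {r}" for i :: nat
    using subgroup.one_closed[OF L] subgroup.m_closed[OF L] generate.incl[of r "{r}" G]
    by (induction i) auto
  have sL: "s \<notin> generate G {r}"
    using ord_dvd_card_subgroup[OF L, of s] generate_pow_card[OF r(1)] r(2) s(2) by auto
  have cancel: "y \<in> generate G {r}"
    if "x \<in> generate G {r}" "y \<in> carrier G" "x \<otimes> y \<in> generate G {r}" for x y
  proof -
    have x: "x \<in> carrier G" using that(1) subgroup.subset[OF L] by blast
    have "inv x \<otimes> (x \<otimes> y) \<in> generate G {r}"
      using that subgroup.m_closed[OF L] subgroup.m_inv_closed[OF L] by blast
    then show ?thesis using x that(2) by (simp add: m_assoc[symmetric])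
  qed
  \<comment> \<open>Elements with and without the factor \<open>s\<close> lie in different cosets of the subgroup of \<open>r\<close>.\<close>
  have rs: "r [^] i \<otimes> s \<noteq> r [^] k" for i k :: nat
    using cancel[OF rL s(1), of i] rL[of k] sL by auto
  have lt2: "j = 0 \<or> j = 1" if "j < 2" for j :: nat using that by linarith
  let ?f = "\<lambda>(i::nat, j::nat). r [^] i \<otimes> s [^] j"
  have inj: "inj_on ?f ({..<3} \<times> {..<2})"
  proof (rule inj_onI, clarify)
    fix i j k l :: nat
    assume lt: "i < 3" "j < 2" "k < 3" "l < 2" and eq: "r [^] i \<otimes> s [^] j = r [^] k \<otimes> s [^] l"
    have jl: "j = l"
      using lt2[OF lt(2)] lt2[OF lt(4)] eq rs[of i k] rs[of k i] r(1) s(1) by auto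
    then have "r [^] i = r [^] k" using eq r(1) s(1) by simp
    then have "i = k" using ord_inj[OF r(1)] r(2) lt by (auto simp: inj_on_def)
    then show "i = k \<and> j = l" using jl by simp
  qed
  have "?f ` ({..<3} \<times> {..<2}) = carrier G"
    using card_image[OF inj] r(1) s(1) G
    by (intro card_subset_eq[OF fin]) (auto simp: order_def card_cartesian_product)
  then have bij: "bij_betw ?f ({..<3} \<times> {..<2}) (carrier G)" using inj by (simp add: bij_betw_def)
  have "s \<otimes> r \<in> ?f ` ({..<3} \<times> {..<2})"
    using bij_betw_imp_surj_on[OF bij] r(1) s(1) by simp
  then obtain i j :: nat where ij: "i < 3" "j < 2" "s \<otimes> r = r [^] i \<otimes> s [^] j" by auto
  have "j \<noteq> 0"
  proof
    assume "j = 0"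
    then have "s \<otimes> r = r [^] i" using ij r(1) by simp
    then have "s = r [^] i \<otimes> inv r" using r(1) s(1) by (simp add: inv_solve_right)
    moreover have "r [^] i \<otimes> inv r \<in> generate G {r}"
      using rL[of i] rL[of 1] r(1) subgroup.m_closed[OF L] subgroup.m_inv_closed[OF L] by simp
    ultimately show False using sL by simp
  qed
  then have "j = 1" using lt2[OF ij(2)] by simp
  then have sr: "s \<otimes> r = r [^] i \<otimes> s" using ij(3) s(1) by simp
  have r1: "r \<noteq> \<one>" using r by auto
  have "i \<noteq> 0" using sr r(1) s(1) r1 by (intro notI) (simp add: r_cancel_one)
  moreover have "i \<noteq> 1"
  proof
    assume "i = 1"
    then have com: "r \<otimes> s = s \<otimes> r" using sr r(1) by simp
    have pow: "(r \<otimes> s) [^] n = r [^] n \<otimes> s [^] n" for n :: nat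
      using pow_mult_distrib[OF com r(1) s(1)] .
    have "r \<otimes> s \<in> carrier G" using r(1) s(1) by simp
    note rsc = this
    have "(r \<otimes> s) [^] (2::nat) \<noteq> \<one>"
      using pow[of 2] pow_eq_id[OF s(1), of 2] pow_eq_id[OF r(1), of 2] r s by simp
    moreover have "(r \<otimes> s) [^] (3::nat) \<noteq> \<one>"
      using pow[of 3] pow_eq_id[OF s(1), of 3] pow_eq_id[OF r(1), of 3] r s by simp
    ultimately have "\<not> ord (r \<otimes> s) dvd 2" "\<not> ord (r \<otimes> s) dvd 3"
      using pow_eq_id[OF rsc] by simp_all
    moreover have "ord (r \<otimes> s) dvd 6" using ord_dvd_group_order[OF rsc] G by simp
    moreover have "d dvd 6 \<Longrightarrow> d dvd 2 \<or> d dvd 3 \<or> d = 6" for d :: nat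
    proof -
      assume d: "d dvd 6"
      then have "d \<in> {1, 2, 3, 4, 5, 6}" using dvd_imp_le[OF d] by (cases "d = 0") auto
      then show ?thesis using d by auto
    qed
    ultimately show False using no6[OF rsc] by blast
  qed
  ultimately have "i = 2" using ij(1) by linarith
  then have "s \<otimes> r = r [^] (2::nat) \<otimes> s" using sr by simp
  with that r s bij show ?thesis by blast
qed

text \<open>
  The relation moves \<open>s\<close> past powers of \<open>r\<close> at the price of doubling the exponent, since
  \<open>r\<^sup>2 = r\<inverse>\<close>.  The factor \<open>1 + j\<close> records the doubling: it is 1 for \<open>j = 0\<close> and 2 for \<open>j = 1\<close>.
\<close>

lemma dihedral_product:
  assumes r: "r \<in> carrier G" "ord r = 3" and s: "s \<in> carrier G" "ord s = 2"
    and rel: "s \<otimes> r = r [^] (2::nat) \<otimes> s" and j: "j < 2"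
  shows "r [^] ((i + k * (1 + j)) mod 3) \<otimes> s [^] ((j + l) mod 2) =
    (r [^] (i::nat) \<otimes> s [^] (j::nat)) \<otimes> (r [^] (k::nat) \<otimes> s [^] (l::nat))"
proof -
  have sr: "s \<otimes> r [^] k = r [^] (2 * k) \<otimes> s" for k :: nat
  proof (induction k)
    case (Suc k)
    have "s \<otimes> r [^] Suc k = (s \<otimes> r [^] k) \<otimes> r" using r s by (simp add: m_assoc)
    also have "\<dots> = r [^] (2 * k) \<otimes> (s \<otimes> r)" using Suc r s by (simp add: m_assoc)
    also have "\<dots> = r [^] (2 * k) \<otimes> r [^] (2::nat) \<otimes> s" using rel r s by (simp add: m_assoc)
    also have "\<dots> = r [^] (2 * Suc k) \<otimes> s" using r by (simp only: nat_pow_mult) simp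
    finally show ?case .
  qed (use r s in simp)
  have swap: "s [^] j \<otimes> r [^] k = r [^] (k * (1 + j)) \<otimes> s [^] j"
  proof -
    consider "j = 0" | "j = 1" using j by linarith
    then show ?thesis
    proof cases
      case 1
      then show ?thesis using r s by simp
    next
      case 2
      then have "s [^] j = s" "k * (1 + j) = 2 * k" using s(1) by simp_all
      then show ?thesis using sr[of k] by (simp only:)
    qed
  qed
  have "(r [^] i \<otimes> s [^] j) \<otimes> (r [^] k \<otimes> s [^] l) =
      r [^] i \<otimes> (s [^] j \<otimes> r [^] k) \<otimes> s [^] l" using r s by (simp add: m_assoc)
  also have "\<dots> = (r [^] i \<otimes> r [^] (k * (1 + j))) \<otimes> (s [^] j \<otimes> s [^] l)"
    unfolding swap using r(1) s(1) by (simp add: m_assoc)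
  also have "\<dots> = r [^] (i + k * (1 + j)) \<otimes> s [^] (j + l)"
    using r(1) s(1) by (simp only: nat_pow_mult)
  finally show ?thesis
    using pow_mod_ord[OF r(1), of "i + k * (1 + j)"] pow_mod_ord[OF s(1), of "j + l"] r(2) s(2)
    by simp
qed

lemma order6_table:
  assumes "order G = 6" "\<And>x. x \<in> carrier G \<Longrightarrow> ord x \<noteq> 6"
  shows "\<exists>f :: nat \<times> nat \<Rightarrow> 'a. bij_betw f ({..<3} \<times> {..<2}) (carrier G) \<and>
    (\<forall>i j k l. j < 2 \<longrightarrow>
      f ((i + k * (1 + j)) mod 3, (j + l) mod 2) = f (i, j) \<otimes> f (k, l))"
proof -
  obtain r s where rs: "r \<in> carrier G" "s \<in> carrier G" "ord r = 3" "ord s = 2"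
    and bij: "bij_betw (\<lambda>(i::nat, j::nat). r [^] i \<otimes> s [^] j) ({..<3} \<times> {..<2}) (carrier G)"
    and rel: "s \<otimes> r = r [^] (2::nat) \<otimes> s"
    using order6_relations[OF assms] .
  show ?thesis
    using bij dihedral_product[OF rs(1,3,2,4) rel]
    by (intro exI[of _ "\<lambda>(i, j). r [^] i \<otimes> s [^] j"]) simp
qed

text \<open>
  Take \<open>S\<close> to be \<open>r\<close> together with the three involutions \<open>t\<^sub>i = r\<^sup>i s\<close>.  Of two distinct members at
  least one is an involution, so a subgroup containing both has an even order that is at least 3
  and divides 6.
\<close>

lemma card_free_configs_order6:
  assumes A: "finite A" and G: "order G = 6" and no6: "\<And>x. x \<in> carrier G \<Longrightarrow> ord x \<noteq> 6"
  shows "card (free_configs G A) + card A ^ 2 + 3 * card A ^ 3 = card A ^ 6 + 3 * card A"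
proof -
  have fin: "finite (carrier G)" using G order_gt_0_iff_finite by simp
  obtain r s where rs: "r \<in> carrier G" "s \<in> carrier G" "ord r = 3" "ord s = 2"
    and bij: "bij_betw (\<lambda>(i::nat, j::nat). r [^] i \<otimes> s [^] j) ({..<3} \<times> {..<2}) (carrier G)"
    and rel: "s \<otimes> r = r [^] (2::nat) \<otimes> s"
    using order6_relations[OF G no6] .
  define t where "t i = r [^] i \<otimes> s" for i :: nat
  have tc: "t i \<in> carrier G" for i using rs by (simp add: t_def)
  have s1: "s [^] (1::nat) = s" using rs by simp
  have inj: "inj_on t {..<3}"
  proof (rule inj_onI)
    fix i k :: nat assume ik: "i \<in> {..<3}" "k \<in> {..<3}" "t i = t k"
    then have "(i, 1::nat) = (k, 1)"
      using s1 by (intro inj_onD[OF bij_betw_imp_inj_on[OF bij]]) (auto simp: t_def)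
    then show "i = k" by simp
  qed
  have t_ord: "ord (t i) = 2" if i: "i < 3" for i
  proof (rule ord_eq_2[OF tc])
    show "t i \<noteq> \<one>"
    proof
      assume "t i = \<one>"
      then have "r [^] i \<otimes> s [^] (1::nat) = r [^] (0::nat) \<otimes> s [^] (0::nat)"
        using rs s1 by (simp add: t_def)
      then have "(i, 1::nat) = (0, 0)"
        using i by (intro inj_onD[OF bij_betw_imp_inj_on[OF bij]]) auto
      then show False by simp
    qed
    have "(i + i * (1 + 1)) mod 3 = 0" by presburger
    then show "t i \<otimes> t i = \<one>"
      using dihedral_product[OF rs(1,3,2,4) rel, of 1 i i 1] rs s1 by (simp add: t_def)
  qed
  define S where "S = insert r (t ` {..<3})"
  have r_notin: "r \<notin> t ` {..<3}" using t_ord rs(3) by auto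
  have S_ord: "g = r \<or> ord g = 2" if "g \<in> S" for g using that t_ord by (auto simp: S_def)
  have one_notin: "\<one> \<notin> S"
  proof
    assume "\<one> \<in> S"
    then have "ord \<one> = 3 \<or> ord \<one> = 2" using S_ord[of \<one>] rs(3) by metis
    then show False by simp
  qed
  have "L \<inter> S \<noteq> {}" if L: "subgroup L G" "L \<noteq> {\<one>}" for L
  proof -
    obtain g where g: "g \<in> L" "g \<noteq> \<one>" "g \<in> carrier G"
      using L subgroup.one_closed[OF L(1)] subgroup.subset[OF L(1)] by blast
    have "g \<in> (\<lambda>(i::nat, j::nat). r [^] i \<otimes> s [^] j) ` ({..<3} \<times> {..<2})"
      using bij_betw_imp_surj_on[OF bij] g(3) by simp
    then obtain i j :: nat where ij: "i < 3" "j < 2" "g = r [^] i \<otimes> s [^] j" by auto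
    show ?thesis
    proof (cases "j = 0")
      case True
      then have gi: "g = r [^] i" using ij rs by simp
      have "i = 1 \<or> i = 2" using ij(1) g(2) gi by (cases "i = 0") auto
      moreover have "r [^] (2::nat) \<otimes> r [^] (2::nat) = r"
        using rs pow_mod_ord[OF rs(1), of 4] by (simp add: nat_pow_mult)
      ultimately have "r \<in> L"
        using gi g(1) subgroup.m_closed[OF L(1) g(1) g(1)] rs(1) by auto
      then show ?thesis by (auto simp: S_def)
    next
      case False
      then have "j = 1" using ij(2) by linarith
      then have "g = t i" using ij(3) rs(2) by (simp add: t_def)
      then show ?thesis using g(1) ij(1) by (auto simp: S_def)
    qed
  qed
  moreover have "L = carrier G"
    if L: "subgroup L G" and gh: "g \<in> S \<inter> L" "h \<in> S \<inter> L" "g \<noteq> h" for L g h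
  proof (rule subgroup_eq_carrier[OF L fin])
    have "g \<noteq> \<one>" "h \<noteq> \<one>" using gh one_notin by auto
    then have "card {\<one>, g, h} = 3" using gh by auto
    moreover have "card {\<one>, g, h} \<le> card L"
      using gh subgroup.one_closed[OF L] finite_subset[OF subgroup.subset[OF L] fin]
      by (intro card_mono) auto
    ultimately have "3 \<le> card L" by simp
    moreover have "2 dvd card L"
    proof -
      have "ord g = 2 \<or> ord h = 2" using gh S_ord by blast
      then show ?thesis
        using ord_dvd_card_subgroup[OF L, of g] ord_dvd_card_subgroup[OF L, of h] gh by auto
    qed
    moreover have "card L dvd 6" using card_subgroup_dvd[OF L] G by simp
    moreover have "d = 6" if "d dvd 6" "2 dvd d" "3 \<le> d" for d :: nat
    proof -
      have "d \<in> {3, 4, 5, 6}" using dvd_imp_le[OF that(1)] that(3) by auto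
      then show ?thesis using that by auto
    qed
    ultimately show "card L = order G" using G by simp
  qed
  moreover have "S \<subseteq> carrier G" "\<one> \<notin> S" "S \<noteq> {}"
    using rs tc one_notin by (auto simp: S_def)
  ultimately have "card (free_configs G A) + card A +
      (\<Sum>g\<in>S. card A ^ (order G div ord g) - card A) = card A ^ order G"
    by (intro card_free_configs[OF fin A])
  moreover have "(\<Sum>g\<in>S. card A ^ (order G div ord g) - card A) =
      (card A ^ 2 - card A) + 3 * (card A ^ 3 - card A)"
    using r_notin t_ord rs(3) G card_image[OF inj]
    by (simp add: S_def sum.reindex[OF inj])
  moreover have "card A \<le> card A ^ 2" "card A \<le> card A ^ 3"
    by (simp_all add: power2_eq_square power3_eq_cube)
  ultimately show ?thesis using G by simp
qed

end

lemma iso_squares_trivial: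
  assumes "G \<cong> G'" "group G" "group G'" and sq: "\<And>y. y \<in> carrier G' \<Longrightarrow> y \<otimes>\<^bsub>G'\<^esub> y = \<one>\<^bsub>G'\<^esub>"
    and x: "x \<in> carrier G"
  shows "x \<otimes>\<^bsub>G\<^esub> x = \<one>\<^bsub>G\<^esub>"
proof -
  interpret G: group G by fact
  obtain h where h: "h \<in> iso G G'" using assms(1) by (auto simp: is_iso_def)
  then have hom: "h \<in> hom G G'" and inj: "inj_on h (carrier G)" by (auto simp: iso_iff)
  have "h (x \<otimes>\<^bsub>G\<^esub> x) = h x \<otimes>\<^bsub>G'\<^esub> h x" using hom x by (simp add: hom_mult)
  also have "\<dots> = \<one>\<^bsub>G'\<^esub>" using sq hom_in_carrier[OF hom x] by simp
  also have "\<dots> = h \<one>\<^bsub>G\<^esub>" using hom_one[OF hom assms(2,3)] by simp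
  finally show ?thesis using inj x by (simp add: inj_on_eq_iff)
qed

lemma klein4_model:
  defines "V \<equiv> integer_mod_group 2 \<times>\<times> integer_mod_group 2"
  shows "group V" "order V = 4" "\<And>x. x \<in> carrier V \<Longrightarrow> x \<otimes>\<^bsub>V\<^esub> x = \<one>\<^bsub>V\<^esub>"
proof -
  show "group V" unfolding V_def by (intro DirProd_group) simp_all
  show "order V = 4" by (simp add: V_def order_def carrier_integer_mod_group card_cartesian_product)
  have "(i + i) mod 2 = 0" for i :: int by presburger
  then show "x \<otimes>\<^bsub>V\<^esub> x = \<one>\<^bsub>V\<^esub>" if "x \<in> carrier V" for x
    using that by (auto simp: V_def)
qed

lemma not_iso_cyclic4_klein4:
  "\<not> integer_mod_group 4 \<cong> integer_mod_group 2 \<times>\<times> integer_mod_group 2"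
proof
  assume iso: "integer_mod_group 4 \<cong> integer_mod_group 2 \<times>\<times> integer_mod_group 2"
  have "1 \<otimes>\<^bsub>integer_mod_group 4\<^esub> 1 = \<one>\<^bsub>integer_mod_group 4\<^esub>"
    using iso group_integer_mod_group klein4_model(1,3) by (rule iso_squares_trivial) simp_all
  then show False by simp
qed

text \<open>
  A homomorphic image of \<open>Z\<^sub>6\<close> is abelian, but two overlapping transpositions do not commute.
\<close>

lemma not_iso_cyclic6_sym3: "\<not> integer_mod_group 6 \<cong> sym_group 3"
proof
  assume "integer_mod_group 6 \<cong> sym_group 3"
  then obtain h where hom: "h \<in> hom (integer_mod_group 6) (sym_group 3)"
    and surj: "h ` carrier (integer_mod_group 6) = carrier (sym_group 3)"
    by (auto simp: is_iso_def iso_iff)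
  let ?p = "transpose 1 (2::nat)" and ?q = "transpose 2 (3::nat)"
  have "?p \<in> carrier (sym_group 3)" "?q \<in> carrier (sym_group 3)"
    by (auto simp: sym_group_carrier intro: permutes_swap_id)
  then have "?p \<in> h ` carrier (integer_mod_group 6)" "?q \<in> h ` carrier (integer_mod_group 6)"
    using surj by simp_all
  then obtain x y where x: "x \<in> carrier (integer_mod_group 6)" "?p = h x"
    and y: "y \<in> carrier (integer_mod_group 6)" "?q = h y"
    by blast
  have "?p \<circ> ?q = h (x \<otimes>\<^bsub>integer_mod_group 6\<^esub> y)"
    using hom_mult[OF hom x(1) y(1)] x(2) y(2) by (simp add: sym_group_mult)
  also have "\<dots> = h (y \<otimes>\<^bsub>integer_mod_group 6\<^esub> x)" by (simp add: add.commute)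
  also have "\<dots> = ?q \<circ> ?p"
    using hom_mult[OF hom y(1) x(1)] x(2) y(2) by (simp add: sym_group_mult)
  finally have "(?p \<circ> ?q) 1 = (?q \<circ> ?p) 1" by simp
  then show False by (simp add: transpose_def)
qed

section \<open>Classification and the values of the orbit count\<close>

lemma order4_cases:
  assumes "group K" "order K = 4" "finite A"
  obtains
    "K \<cong> integer_mod_group 4" "card (free_configs K A) + card A ^ 2 = card A ^ 4"
  | "K \<cong> integer_mod_group 2 \<times>\<times> integer_mod_group 2"
    "card (free_configs K A) + 3 * card A ^ 2 = card A ^ 4 + 2 * card A"
proof -
  interpret group K by fact
  have fin: "finite (carrier K)" using assms(2) order_gt_0_iff_finite by simp
  show ?thesis
  proof (cases "\<exists>a\<in>carrier K. ord a = 4")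
    case True
    then obtain a where a: "a \<in> carrier K" "ord a = 4" by blast
    show ?thesis
      using that(1) iso_integer_mod_group[OF fin a(1)] card_free_configs_cyclic4[OF fin assms(3,2) a]
        a(2) assms(2) by simp
  next
    case False
    have sq: "x \<otimes>\<^bsub>K\<^esub> x = \<one>\<^bsub>K\<^esub>" if x: "x \<in> carrier K" for x
    proof -
      have d: "ord x dvd 4" using ord_dvd_group_order[OF x] assms(2) by simp
      then have "ord x \<in> {1, 2, 3, 4}" using dvd_imp_le[OF d] by (cases "ord x = 0") auto
      then have "ord x dvd 2" using d False x by auto
      then have "x [^]\<^bsub>K\<^esub> (2::nat) = \<one>\<^bsub>K\<^esub>" using pow_eq_id[OF x] by simp
      then show ?thesis using x by (simp add: numeral_2_eq_2)
    qed
    let ?V = "integer_mod_group 2 \<times>\<times> integer_mod_group 2"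
    obtain f :: "bool \<times> bool \<Rightarrow> 'a" where f: "bij_betw f UNIV (carrier K)"
      "\<And>i j k l. f (i \<noteq> k, j \<noteq> l) = f (i, j) \<otimes>\<^bsub>K\<^esub> f (k, l)"
      using klein4_table[OF assms(2) sq] by blast
    obtain f' :: "bool \<times> bool \<Rightarrow> int \<times> int" where f': "bij_betw f' UNIV (carrier ?V)"
      "\<And>i j k l. f' (i \<noteq> k, j \<noteq> l) = f' (i, j) \<otimes>\<^bsub>?V\<^esub> f' (k, l)"
      using group.klein4_table[OF klein4_model] by blast
    have "K \<cong> ?V"
    proof (rule iso_if_same_table[OF f(1) f'(1)])
      fix p q :: "bool \<times> bool"
      let ?m = "\<lambda>p q :: bool \<times> bool. (fst p \<noteq> fst q, snd p \<noteq> snd q)"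
      show "?m p q \<in> UNIV" by simp
      show "f (?m p q) = f p \<otimes>\<^bsub>K\<^esub> f q"
        using f(2)[of "fst p" "fst q" "snd p" "snd q"] by (simp only: prod.collapse)
      show "f' (?m p q) = f' p \<otimes>\<^bsub>?V\<^esub> f' q"
        using f'(2)[of "fst p" "fst q" "snd p" "snd q"] by (simp only: prod.collapse)
    qed
    then show ?thesis using that(2) card_free_configs_klein4[OF assms(3,2) sq] by simp
  qed
qed

lemma order6_cases:
  assumes "group K" "order K = 6" "finite A"
  obtains
    "K \<cong> integer_mod_group 6"
    "card (free_configs K A) + card A ^ 2 + card A ^ 3 = card A ^ 6 + card A"
  | "K \<cong> sym_group 3"
    "card (free_configs K A) + card A ^ 2 + 3 * card A ^ 3 = card A ^ 6 + 3 * card A"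
proof -
  interpret group K by fact
  interpret Sym: group "sym_group 3" by (rule sym_group_is_group)
  have fin: "finite (carrier K)" using assms(2) order_gt_0_iff_finite by simp
  show ?thesis
  proof (cases "\<exists>a\<in>carrier K. ord a = 6")
    case True
    then obtain a where a: "a \<in> carrier K" "ord a = 6" by blast
    show ?thesis
      using that(1) iso_integer_mod_group[OF fin a(1)] card_free_configs_cyclic6[OF fin assms(3,2) a]
        a(2) assms(2) by simp
  next
    case False
    then have no6: "\<And>x. x \<in> carrier K \<Longrightarrow> ord x \<noteq> 6" by blast
    have sym6: "order (sym_group 3) = 6"
      using sym_group_card_carrier[of 3] by (simp add: order_def fact_numeral)
    have finS: "finite (carrier (sym_group 3))" using sym6 Sym.order_gt_0_iff_finite by simp
    \<comment> \<open>An element of order 6 would make \<open>S\<^sub>3\<close> cyclic, hence abelian, so the table applies to \<open>S\<^sub>3\<close> as well.\<close>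
    have symno6: "Sym.ord x \<noteq> 6" if "x \<in> carrier (sym_group 3)" for x
      using Sym.iso_integer_mod_group[OF finS that] sym6 Sym.iso_sym not_iso_cyclic6_sym3 by auto
    obtain f :: "nat \<times> nat \<Rightarrow> 'a" where f: "bij_betw f ({..<3} \<times> {..<2}) (carrier K)"
      "\<And>i j k l. j < 2 \<Longrightarrow> f ((i + k * (1 + j)) mod 3, (j + l) mod 2) = f (i, j) \<otimes>\<^bsub>K\<^esub> f (k, l)"
      using order6_table[OF assms(2) no6] by blast
    obtain f' :: "nat \<times> nat \<Rightarrow> nat \<Rightarrow> nat"
      where f': "bij_betw f' ({..<3} \<times> {..<2}) (carrier (sym_group 3))"
      "\<And>i j k l. j < 2 \<Longrightarrow>
        f' ((i + k * (1 + j)) mod 3, (j + l) mod 2) = f' (i, j) \<otimes>\<^bsub>sym_group 3\<^esub> f' (k, l)"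
      using Sym.order6_table[OF sym6 symno6] by blast
    have "K \<cong> sym_group 3"
    proof (rule iso_if_same_table[OF f(1) f'(1)])
      fix p q :: "nat \<times> nat" assume "p \<in> {..<3} \<times> {..<2}"
      then have p: "snd p < 2" by auto
      let ?m = "\<lambda>p q :: nat \<times> nat.
        ((fst p + fst q * (1 + snd p)) mod 3, (snd p + snd q) mod 2)"
      show "?m p q \<in> {..<3} \<times> {..<2}" by simp
      show "f (?m p q) = f p \<otimes>\<^bsub>K\<^esub> f q"
        using f(2)[OF p, of "fst p" "fst q" "snd q"] by (simp only: prod.collapse)
      show "f' (?m p q) = f' p \<otimes>\<^bsub>sym_group 3\<^esub> f' q"
        using f'(2)[OF p, of "fst p" "fst q" "snd q"] by (simp only: prod.collapse)
    qed
    then show ?thesis using that(2) card_free_configs_order6[OF assms(3,2) no6] by simp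
  qed
qed

text \<open>
  The complete table of the orbit counts up to 10.  The case \<open>large\<close> also records which pairs
  of order and alphabet size fall under it: to deduce the orbit count from a given pair, one
  has to know that the pair is not among these.
\<close>

lemma (in group) orbit_count_values:
  assumes "H \<lhd> G" "H \<noteq> carrier G" "finite (rcosets H)" "finite A" "card A \<ge> 2"
  obtains
    (large) "num_orbits_stab G A H > 10" "order (G Mod H) \<ge> 2" "order (G Mod H) = 2 \<Longrightarrow> card A \<ge> 6"
      "order (G Mod H) = 3 \<Longrightarrow> card A \<ge> 4"
      "4 \<le> order (G Mod H) \<Longrightarrow> order (G Mod H) \<le> 6 \<Longrightarrow> card A \<ge> 3"
  | (small) "(order (G Mod H), card A, num_orbits_stab G A H) \<in>
      {(2, 2, 1), (2, 3, 3), (2, 4, 6), (2, 5, 10), (3, 2, 2), (3, 3, 8), (5, 2, 6)}"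
  | (cyclic4) "card A = 2" "G Mod H \<cong> integer_mod_group 4" "num_orbits_stab G A H = 3"
  | (klein4) "card A = 2" "G Mod H \<cong> integer_mod_group 2 \<times>\<times> integer_mod_group 2" "num_orbits_stab G A H = 2"
  | (cyclic6) "card A = 2" "G Mod H \<cong> integer_mod_group 6" "num_orbits_stab G A H = 9"
  | (sym3) "card A = 2" "G Mod H \<cong> sym_group 3" "num_orbits_stab G A H = 7"
proof -
  interpret N: normal H G by fact
  let ?K = "G Mod H" and ?\<alpha> = "num_orbits_stab G A H"
  interpret K: group ?K by (rule N.factorgroup_is_group)
  define n where "n = order ?K"
  define q where "q = card A"
  have finK: "finite (carrier ?K)" using assms(3) by (simp add: FactGroup_def)
  have q2: "q \<ge> 2" using assms(5) by (simp add: q_def)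
  have free: "?\<alpha> * n = card (free_configs ?K A)"
    unfolding n_def using num_orbits_stab_quotient[OF assms(1,3,4)] .
  have n2: "n \<ge> 2"
  proof -
    obtain g where g: "g \<in> carrier G" "g \<notin> H" using assms(2) N.subset by blast
    then have "H #> g \<noteq> H" using rcos_self[OF g(1) N.is_subgroup] by blast
    then have "card {H, H #> g} = 2" by simp
    moreover have "{H, H #> g} \<subseteq> carrier ?K"
      using g(1) K.one_closed by (auto simp: carrier_FactGroup)
    then have "card {H, H #> g} \<le> n" unfolding n_def order_def using finK by (rule card_mono[rotated])
    ultimately show ?thesis by simp
  qed
  show ?thesis
  proof (cases "(n = 2 \<longrightarrow> q \<ge> 6) \<and> (n = 3 \<longrightarrow> q \<ge> 4) \<and> (4 \<le> n \<and> n \<le> 6 \<longrightarrow> q \<ge> 3)")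
    case True
    have "A \<noteq> {}" using q2 by (auto simp: q_def)
    then have "q ^ n \<le> ?\<alpha> * n + (n - 1) * q ^ (n div 2)"
      using K.card_free_configs_ge[OF finK assms(4)] free by (simp add: n_def q_def)
    moreover have "(n - 1) * q ^ (n div 2) + 10 * n < q ^ n"
      by (rule many_free_configs_bound[OF n2 q2]) (use True in auto)
    ultimately have "10 * n < ?\<alpha> * n" by linarith
    then have "?\<alpha> > 10" by simp
    then show ?thesis using large n2 True by (simp add: n_def q_def)
  next
    case False
    then consider "n \<in> {2, 3, 5}" | "n = 4" "q = 2" | "n = 6" "q = 2"
      using q2 by fastforce
    then show ?thesis
    proof cases
      case 1
      then have "Factorial_Ring.prime (order ?K)" by (auto simp: n_def)
      then have eq: "?\<alpha> * n + q = q ^ n"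
        using K.card_free_configs_prime_order[OF finK assms(4)] free by (simp add: n_def q_def)
      have "(n, q) \<in> {(2, 2), (2, 3), (2, 4), (2, 5), (3, 2), (3, 3), (5, 2)}"
      proof -
        have "n = 2 \<Longrightarrow> q \<in> {2, 3, 4, 5}" "n = 3 \<Longrightarrow> q \<in> {2, 3}" "n = 5 \<Longrightarrow> q = 2"
          using False q2 by auto
        then show ?thesis using 1 by auto
      qed
      then have "(n, q, ?\<alpha>) \<in>
          {(2, 2, 1), (2, 3, 3), (2, 4, 6), (2, 5, 10), (3, 2, 2), (3, 3, 8), (5, 2, 6)}"
        unfolding insert_iff empty_iff prod.inject using eq by (elim disjE conjE) simp_all
      then show ?thesis using small unfolding n_def q_def by blast
    next
      case 2
      then have "order ?K = 4" by (simp add: n_def)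
      show ?thesis
      proof (rule order4_cases[OF K.is_group \<open>order ?K = 4\<close> assms(4)], goal_cases)
        case 1
        then have "?\<alpha> = 3" using free 2 by (simp add: n_def q_def)
        then show ?thesis using cyclic4 1(1) 2 by (simp add: q_def)
      next
        case 2
        then have "?\<alpha> = 2" using free \<open>n = 4\<close> \<open>q = 2\<close> by (simp add: n_def q_def)
        then show ?thesis using klein4 2(1) \<open>q = 2\<close> by (simp add: q_def)
      qed
    next
      case 3
      then have "order ?K = 6" by (simp add: n_def)
      show ?thesis
      proof (rule order6_cases[OF K.is_group \<open>order ?K = 6\<close> assms(4)], goal_cases)
        case 1
        then have "?\<alpha> = 9" using free 3 by (simp add: n_def q_def)
        then show ?thesis using cyclic6 1(1) 3 by (simp add: q_def)
      next
        case 2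
        then have "?\<alpha> = 7" using free 3 by (simp add: n_def q_def)
        then show ?thesis using sym3 2(1) 3 by (simp add: q_def)
      qed
    qed
  qed
qed

theorem theorem3:
  fixes G :: "('a, 'm) monoid_scheme" and H :: "'a set" and A :: "'b set"
  assumes "group G"
    and "finitely_generated G"
    and "H \<lhd> G"
    and "H \<noteq> carrier G"
    and "finite (rcosets\<^bsub>G\<^esub> H)"
    and "finite A"
    and "card A \<ge> 2"
  shows "(num_orbits_stab G A H = 1 \<longleftrightarrow> card A = 2 \<and> card (rcosets\<^bsub>G\<^esub> H) = 2) \<and>
    (num_orbits_stab G A H = 2 \<longleftrightarrow>
      (card A = 2 \<and> card (rcosets\<^bsub>G\<^esub> H) = 3) \<or>
      (card A = 2 \<and> G Mod H \<cong> integer_mod_group 2 \<times>\<times> integer_mod_group 2)) \<and>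
    (num_orbits_stab G A H = 3 \<longleftrightarrow>
      (card A = 3 \<and> card (rcosets\<^bsub>G\<^esub> H) = 2) \<or>
      (card A = 2 \<and> G Mod H \<cong> integer_mod_group 4)) \<and>
    (num_orbits_stab G A H = 6 \<longleftrightarrow>
      (card A = 2 \<and> card (rcosets\<^bsub>G\<^esub> H) = 5) \<or>
      (card A = 4 \<and> card (rcosets\<^bsub>G\<^esub> H) = 2)) \<and>
    (num_orbits_stab G A H = 7 \<longleftrightarrow> card A = 2 \<and> G Mod H \<cong> sym_group 3) \<and>
    (num_orbits_stab G A H = 8 \<longleftrightarrow> card A = 3 \<and> card (rcosets\<^bsub>G\<^esub> H) = 3) \<and>
    (num_orbits_stab G A H = 9 \<longleftrightarrow> card A = 2 \<and> G Mod H \<cong> integer_mod_group 6) \<and>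
    (num_orbits_stab G A H = 10 \<longleftrightarrow> card A = 5 \<and> card (rcosets\<^bsub>G\<^esub> H) = 2) \<and>
    (num_orbits_stab G A H \<noteq> 4 \<and> num_orbits_stab G A H \<noteq> 5)"
proof -
  let ?K = "G Mod H"
  interpret K: group ?K using assms(3) by (rule normal.factorgroup_is_group)
  have index: "card (rcosets\<^bsub>G\<^esub> H) = order ?K" by (simp add: order_def FactGroup_def)
  have Z: "order ?K = m" if "?K \<cong> integer_mod_group m" "m > 0" for m
    using iso_same_card[OF that(1)] that(2) by (simp add: order_def carrier_integer_mod_group)
  have V4: "order ?K = 4" if "?K \<cong> integer_mod_group 2 \<times>\<times> integer_mod_group 2"
    using iso_same_card[OF that] klein4_model(2) by (simp add: order_def)
  have order4: "\<not> ?K \<cong> integer_mod_group 4" "\<not> ?K \<cong> integer_mod_group 2 \<times>\<times> integer_mod_group 2"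
    if "order ?K \<noteq> 4"
    using that Z[of 4] V4 by auto
  have order6: "\<not> ?K \<cong> integer_mod_group 6" "\<not> ?K \<cong> sym_group 3" if "order ?K \<noteq> 6"
    using that Z[of 6] iso_same_card[of ?K "sym_group 3"]
    by (auto simp: order_def sym_group_card_carrier fact_numeral)
  \<comment> \<open>The two types of order 4, and likewise of order 6, exclude each other; the converse directions rest on this.\<close>
  have dist4: "\<not> (?K \<cong> integer_mod_group 4 \<and> ?K \<cong> integer_mod_group 2 \<times>\<times> integer_mod_group 2)"
    using K.iso_sym iso_trans not_iso_cyclic4_klein4 by blast
  have dist6: "\<not> (?K \<cong> integer_mod_group 6 \<and> ?K \<cong> sym_group 3)"
    using K.iso_sym iso_trans not_iso_cyclic6_sym3 by blast
  show ?thesis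
  proof (rule group.orbit_count_values[OF assms(1,3-7)],
      goal_cases large small cyclic4 klein4 cyclic6 sym3)
    case large
    then have "card A \<ge> 6 \<or> order ?K \<noteq> 2" "card A \<ge> 4 \<or> order ?K \<noteq> 3"
      "card A \<ge> 3 \<or> order ?K \<noteq> 4 \<and> order ?K \<noteq> 5 \<and> order ?K \<noteq> 6"
      by auto
    then show ?thesis using large(1) order4 order6 unfolding index by auto
  next
    case small
    then show ?thesis
      unfolding index insert_iff empty_iff prod.inject
      by (elim disjE conjE) (simp_all add: order4 order6)
  next
    case cyclic4
    then have "order ?K = 4" using order4(1) by blast
    then show ?thesis using cyclic4 dist4 order6 unfolding index by simp
  next
    case klein4
    then have "order ?K = 4" using order4(2) by blast
    then show ?thesis using klein4 dist4 order6 unfolding index by simp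
  next
    case cyclic6
    then have "order ?K = 6" using order6(1) by blast
    then show ?thesis using cyclic6 dist6 order4 unfolding index by simp
  next
    case sym3
    then have "order ?K = 6" using order6(2) by blast
    then show ?thesis using sym3 dist6 order4 unfolding index by simp
  qed
qed

end
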